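(* Let $K$ be a field of any characteristic, let $\Omega$ be a set of multilinear operations as in the context, and let $J$ be an $\Omega$-ideal of the free $\Omega$-algebra $K\{X\}_{\Omega}$ that is homogeneous with respect to any $\mathbb{Z}^d$-grading of $K\{X\}_{\Omega}$ (as in the context). Then the Hilbert series of the factor algebra $A\cong K\{X\}_{\Omega}/J$ and the generating functions of the set of generators $X$ and of the reduced Gröbner basis $B(J)$ of $J$ with respect to any admissible ordering are related by $$H(A,t_1,\ldots,t_d)=H\big(K\{x\}_{\Omega},\,G(X,t_1,\ldots,t_d)-G(B(J),t_1,\ldots,t_d)\big).$$
   Context: $\Omega=\bigcup_{n\ge 2}\Omega_n$, where $\Omega_n=\{\nu_{ni}\mid i=1,\ldots,p_n\}$ is a finite set (possibly empty) of $n$-ary operation symbols. For a set $X$, the free $\Omega$-magma $\{X\}_{\Omega}$ (the set of $\Omega$-monomials) is the smallest set of formal expressions containing $X$ and containing $\nu_{ni}(u_1,\ldots,u_n)$ whenever $\nu_{ni}\in\Omega$ and $u_1,\ldots,u_n\in\{X\}_{\Omega}$. The (nonunitary) free $\Omega$-algebra $K\{X\}_{\Omega}$ is the $K$-vector space with basis $\{X\}_{\Omega}$, with the operations of $\Omega$ extended multilinearly. An $\Omega$-ideal is a subspace $J$ such that $\nu_{ni}(u_1,\ldots,u_n)\in J$ whenever some $u_j\in J$. $\mathbb{Z}^d$-grading: $X$ is countable (finite or infinite), each $x_j\in X$ is assigned a degree $(a_{j1},\ldots,a_{jd})$ with integers $a_{jk}\ge0$, with only finitely many generators of each degree, and the degree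 of $\nu_{ni}(u_1,\ldots,u_n)$ is the sum of the degrees of the $u_j$. For a graded space $V$, $H(V,t_1,\ldots,t_d)=\sum\dim(V^{(k_1,\ldots,k_d)})t_1^{k_1}\cdots t_d^{k_d}$, where $V^{(k_1,\ldots,k_d)}$ is the homogeneous component of degree $(k_1,\ldots,k_d)$; for a set $W$ of homogeneous elements, $G(W,t_1,\ldots,t_d)=\sum\#(W^{(k_1,\ldots,k_d)})t_1^{k_1}\cdots t_d^{k_d}$, where $W^{(k_1,\ldots,k_d)}$ is the set of elements of $W$ of that degree. $K\{x\}_{\Omega}$ is the free $\Omega$-algebra on one generator $x$, graded by $\deg x=1$, $H(K\{x\}_{\Omega},t)=\sum_{k\ge1}\dim(K\{x\}_{\Omega}^{(k)})t^k$, and $H(K\{x\}_{\Omega},w)$ denotes substitution of the power series $w$ for $t$. An admissible ordering $\prec$ on $\{X\}_{\Omega}$ is a well-ordering such that $u\prec v$ implies $\nu_{ni}(w_1,\ldots,w_{j-1},u,w_{j+1},\ldots,w_n)\prec\nu_{ni}(w_1,\ldots,w_{j-1},v,w_{j+1},\ldots,w_n)$ for all $\nu_{ni}\in\Omega$ and all $w_i\in\{X\}_{\Omega}$. The leading term $\overline f$ of $0\ne f\in K\{X\}_{\Omega}$ is the largest $\Omega$-monomial occurring in $f$ with nonzero coefficient. The subwords of an $\Omega$-monomial $u$ are $u$ itself and, if $u=\nu_{ni}(u_1,\ldots,u_n)$, all subwords of $u_1,\ldots,u_n$. A subset $B$ of $J$ is a Gröbner basis of $J$ if for every $0\neq f\in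 J$ there is $g\in B$, $g\ne0$, such that $\overline g$ is a subword of $\overline f$. The Gröbner basis is reduced if its elements are nonzero with leading coefficient $1$ and no monomial occurring in an element $g\in B$ contains as a subword the leading term of another element of $B$; the reduced Gröbner basis of a homogeneous ideal consists of homogeneous elements.
   Formalization: It is additionally assumed that each degree contains only finitely many Ω-monomials (automatic if no generator has degree 0); otherwise the claim fails, e.g. X={x}, deg x=0, one binary operation, J generated by xx. *)

theory Defs
  imports
    "HOL-Analysis.Analysis"
    "HOL-Library.Poly_Mapping"
    "HOL-Computational_Algebra.Formal_Power_Series"
begin

section \<open>Monomials\<close>

text \<open>
  A signature is a family \<open>\<Omega> :: nat \<Rightarrow> 'o set\<close>, where \<open>\<Omega> n\<close> is the set of \<open>n\<close>-ary operation symbols.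
  Only arities \<open>n \<ge> 2\<close> are ever used. The sets \<open>\<Omega> n\<close> need not be disjoint: in \<open>Op \<nu> us\<close> the arity
  is the length of \<open>us\<close>.
\<close>

datatype ('o, 'x) omonom = Var 'x | Op 'o "('o, 'x) omonom list"

inductive_set omonomials :: "(nat \<Rightarrow> 'o set) \<Rightarrow> 'x set \<Rightarrow> ('o, 'x) omonom set"
  for \<Omega> :: "nat \<Rightarrow> 'o set" and X :: "'x set" where
  Var: "x \<in> X \<Longrightarrow> Var x \<in> omonomials \<Omega> X"
| Op: "2 \<le> length us \<Longrightarrow> \<nu> \<in> \<Omega> (length us) \<Longrightarrow> \<forall>u\<in>set us. u \<in> omonomials \<Omega> X
        \<Longrightarrow> Op \<nu> us \<in> omonomials \<Omega> X"

inductive subword :: "('o, 'x) omonom \<Rightarrow> ('o, 'x) omonom \<Rightarrow> bool" where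
  self: "subword u u"
| arg: "w \<in> set us \<Longrightarrow> subword v w \<Longrightarrow> subword v (Op \<nu> us)"

primrec mdeg :: "('x \<Rightarrow> 'g::comm_monoid_add) \<Rightarrow> ('o, 'x) omonom \<Rightarrow> 'g" where
  "mdeg deg (Var x) = deg x"
| "mdeg deg (Op \<nu> us) = sum_list (map (mdeg deg) us)"

text \<open>The relation \<open>r\<close> is the reflexive form of the ordering; the strict one is \<open>r - Id\<close>.\<close>

definition admissible_ordering ::
    "(nat \<Rightarrow> 'o set) \<Rightarrow> 'x set \<Rightarrow> (('o, 'x) omonom \<times> ('o, 'x) omonom) set \<Rightarrow> bool" where
  "admissible_ordering \<Omega> X r \<longleftrightarrow>
     well_order_on (omonomials \<Omega> X) r \<and>
     (\<forall>n\<ge>2. \<forall>\<nu>\<in>\<Omega> n. \<forall>ws j u v.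
        length ws = n \<longrightarrow> set ws \<subseteq> omonomials \<Omega> X \<longrightarrow> j < n \<longrightarrow> (u, v) \<in> r - Id \<longrightarrow>
        (Op \<nu> (ws[j := u]), Op \<nu> (ws[j := v])) \<in> r - Id)"


section \<open>The free algebra and its ideals\<close>

definition free_alg :: "(nat \<Rightarrow> 'o set) \<Rightarrow> 'x set \<Rightarrow> (('o, 'x) omonom \<Rightarrow>\<^sub>0 'k::field) set" where
  "free_alg \<Omega> X = {f. Poly_Mapping.keys f \<subseteq> omonomials \<Omega> X}"

definition pm_scale :: "'k \<Rightarrow> ('b \<Rightarrow>\<^sub>0 'k) \<Rightarrow> ('b \<Rightarrow>\<^sub>0 'k::field)" where
  "pm_scale c f = Poly_Mapping.map ((*) c) f"

lemma lookup_pm_scale [simp]: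
  "Poly_Mapping.lookup (pm_scale c f) u = c * Poly_Mapping.lookup f u"
  by (simp add: pm_scale_def Poly_Mapping.map.rep_eq when_def)

lemma vector_space_pm_scale: "vector_space pm_scale"
  by unfold_locales (auto intro!: poly_mapping_eqI simp: lookup_add algebra_simps)

text \<open>The multilinear extension of \<open>\<nu>\<close>: expand each \<open>fs ! i\<close> in the basis of monomials.\<close>

definition omega_op ::
    "'o \<Rightarrow> (('o, 'x) omonom \<Rightarrow>\<^sub>0 'k) list \<Rightarrow> (('o, 'x) omonom \<Rightarrow>\<^sub>0 'k::field)" where
  "omega_op \<nu> fs =
     (\<Sum>us\<in>listset (map Poly_Mapping.keys fs).
        Poly_Mapping.single (Op \<nu> us) (\<Prod>i<length fs. Poly_Mapping.lookup (fs ! i) (us ! i)))"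

definition omega_ideal ::
    "(nat \<Rightarrow> 'o set) \<Rightarrow> 'x set \<Rightarrow> (('o, 'x) omonom \<Rightarrow>\<^sub>0 'k::field) set \<Rightarrow> bool" where
  "omega_ideal \<Omega> X J \<longleftrightarrow>
     J \<subseteq> free_alg \<Omega> X \<and> module.subspace pm_scale J \<and>
     (\<forall>n\<ge>2. \<forall>\<nu>\<in>\<Omega> n. \<forall>fs.
        length fs = n \<longrightarrow> set fs \<subseteq> free_alg \<Omega> X \<longrightarrow> (\<exists>f\<in>set fs. f \<in> J) \<longrightarrow> omega_op \<nu> fs \<in> J)"

definition hom_part ::
    "(nat \<Rightarrow> 'o set) \<Rightarrow> 'x set \<Rightarrow> ('x \<Rightarrow> 'g::comm_monoid_add) \<Rightarrow> 'g
      \<Rightarrow> (('o, 'x) omonom \<Rightarrow>\<^sub>0 'k::field) set" where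
  "hom_part \<Omega> X deg k = {f \<in> free_alg \<Omega> X. \<forall>u\<in>Poly_Mapping.keys f. mdeg deg u = k}"

definition hom_comp ::
    "('x \<Rightarrow> 'g::comm_monoid_add) \<Rightarrow> 'g
      \<Rightarrow> (('o, 'x) omonom \<Rightarrow>\<^sub>0 'k) \<Rightarrow> (('o, 'x) omonom \<Rightarrow>\<^sub>0 'k::field)" where
  "hom_comp deg k f =
     (\<Sum>u\<in>{u \<in> Poly_Mapping.keys f. mdeg deg u = k}. Poly_Mapping.single u (Poly_Mapping.lookup f u))"

definition homogeneous_subspace ::
    "('x \<Rightarrow> 'g::comm_monoid_add) \<Rightarrow> (('o, 'x) omonom \<Rightarrow>\<^sub>0 'k::field) set \<Rightarrow> bool" where
  "homogeneous_subspace deg J \<longleftrightarrow> (\<forall>f\<in>J. \<forall>k. hom_comp deg k f \<in> J)"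

text \<open>
  \<open>A\<close>, a subset of a \<open>K\<close>-vector space on the type \<open>'a\<close>, is the factor algebra of the free algebra
  modulo \<open>J\<close> with quotient map \<open>\<pi>\<close>, i.e. \<open>\<pi>\<close> is a homomorphism of \<open>\<Omega>\<close>-algebras from the free
  algebra onto \<open>A\<close> with kernel \<open>J\<close>. The operation of \<open>\<nu> \<in> \<Omega> n\<close> on \<open>A\<close> is \<open>opA \<nu>\<close> on lists of
  length \<open>n\<close>. The factor algebra is graded by the images under \<open>\<pi>\<close> of the homogeneous components.
\<close>

definition factor_algebra ::
    "(nat \<Rightarrow> 'o set) \<Rightarrow> 'x set \<Rightarrow> (('o, 'x) omonom \<Rightarrow>\<^sub>0 'k::field) set
      \<Rightarrow> ('k \<Rightarrow> 'a \<Rightarrow> 'a::ab_group_add) \<Rightarrow> ('o \<Rightarrow> 'a list \<Rightarrow> 'a) \<Rightarrow> 'a set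
      \<Rightarrow> ((('o, 'x) omonom \<Rightarrow>\<^sub>0 'k) \<Rightarrow> 'a) \<Rightarrow> bool" where
  "factor_algebra \<Omega> X J scaleA opA A \<pi> \<longleftrightarrow>
     vector_space scaleA \<and>
     (\<forall>f\<in>free_alg \<Omega> X. \<forall>g\<in>free_alg \<Omega> X. \<pi> (f + g) = \<pi> f + \<pi> g) \<and>
     (\<forall>c. \<forall>f\<in>free_alg \<Omega> X. \<pi> (pm_scale c f) = scaleA c (\<pi> f)) \<and>
     (\<forall>n\<ge>2. \<forall>\<nu>\<in>\<Omega> n. \<forall>fs.
        length fs = n \<longrightarrow> set fs \<subseteq> free_alg \<Omega> X \<longrightarrow> \<pi> (omega_op \<nu> fs) = opA \<nu> (map \<pi> fs)) \<and>
     \<pi> ` free_alg \<Omega> X = A \<and>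
     {f \<in> free_alg \<Omega> X. \<pi> f = 0} = J"


section \<open>Groebner bases\<close>

definition lead :: "('b \<times> 'b) set \<Rightarrow> ('b \<Rightarrow>\<^sub>0 'k::field) \<Rightarrow> 'b" where
  "lead r f = (THE u. u \<in> Poly_Mapping.keys f \<and> (\<forall>v\<in>Poly_Mapping.keys f. (v, u) \<in> r))"

definition groebner_basis ::
    "(('o, 'x) omonom \<times> ('o, 'x) omonom) set \<Rightarrow> (('o, 'x) omonom \<Rightarrow>\<^sub>0 'k::field) set
      \<Rightarrow> (('o, 'x) omonom \<Rightarrow>\<^sub>0 'k) set \<Rightarrow> bool" where
  "groebner_basis r J B \<longleftrightarrow>
     B \<subseteq> J \<and> (\<forall>f\<in>J. f \<noteq> 0 \<longrightarrow> (\<exists>g\<in>B. g \<noteq> 0 \<and> subword (lead r g) (lead r f)))"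

definition reduced_groebner_basis ::
    "(('o, 'x) omonom \<times> ('o, 'x) omonom) set \<Rightarrow> (('o, 'x) omonom \<Rightarrow>\<^sub>0 'k::field) set
      \<Rightarrow> (('o, 'x) omonom \<Rightarrow>\<^sub>0 'k) set \<Rightarrow> bool" where
  "reduced_groebner_basis r J B \<longleftrightarrow>
     groebner_basis r J B \<and>
     (\<forall>g\<in>B. g \<noteq> 0 \<and> Poly_Mapping.lookup g (lead r g) = 1) \<and>
     (\<forall>g\<in>B. \<forall>h\<in>B. h \<noteq> g \<longrightarrow> (\<forall>u\<in>Poly_Mapping.keys g. \<not> subword (lead r h) u))"


section \<open>Power series\<close>

text \<open>
  A formal power series in \<open>t\<^sub>1, \<dots>, t\<^sub>d\<close> over the integers is its function of coefficients, indexed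
  by the vector of exponents; \<open>d\<close> is the cardinality of the index type \<open>'d\<close>.
\<close>

type_synonym 'd mseries = "nat ^ 'd \<Rightarrow> int"

definition mseries_mult :: "'d::finite mseries \<Rightarrow> 'd mseries \<Rightarrow> 'd mseries" where
  "mseries_mult f g = (\<lambda>m. \<Sum>(a, b)\<in>{(a, b). a + b = m}. f a * g b)"

primrec mseries_power :: "'d::finite mseries \<Rightarrow> nat \<Rightarrow> 'd mseries" where
  "mseries_power w 0 = (\<lambda>m. if m = 0 then 1 else 0)"
| "mseries_power w (Suc k) = mseries_mult w (mseries_power w k)"

text \<open>
  Substitution of \<open>w\<close> into \<open>h\<close>. For each exponent \<open>m\<close> only finitely many summands are nonzero if \<open>w\<close>
  has no constant term or if \<open>h\<close> is a polynomial; otherwise the value is meaningless.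
\<close>

definition mseries_subst :: "int fps \<Rightarrow> 'd::finite mseries \<Rightarrow> 'd mseries" where
  "mseries_subst h w =
     (\<lambda>m. \<Sum>k | fps_nth h k * mseries_power w k m \<noteq> 0. fps_nth h k * mseries_power w k m)"

text \<open>\<open>V k\<close> is the homogeneous component of degree \<open>k\<close>, and likewise \<open>W k\<close>.\<close>

definition hilbert_series ::
    "('k::field \<Rightarrow> 'a::ab_group_add \<Rightarrow> 'a) \<Rightarrow> ('g \<Rightarrow> 'a set) \<Rightarrow> 'g \<Rightarrow> int" where
  "hilbert_series scl V = (\<lambda>k. int (vector_space.dim scl (V k)))"

definition generating_series :: "('g \<Rightarrow> 'b set) \<Rightarrow> 'g \<Rightarrow> int" where
  "generating_series W = (\<lambda>k. int (card (W k)))"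

text \<open>The Hilbert series of the free algebra on one generator of degree 1 over the field \<open>'k\<close>.\<close>

definition hilbert_one_gen :: "'k::field itself \<Rightarrow> (nat \<Rightarrow> 'o set) \<Rightarrow> int fps" where
  "hilbert_one_gen _ \<Omega> =
     Abs_fps (hilbert_series pm_scale
       (hom_part \<Omega> {()} (\<lambda>_. 1) :: nat \<Rightarrow> (('o, unit) omonom \<Rightarrow>\<^sub>0 'k) set))"

end

theory Submission
  imports Defs
begin

text \<open>
  Let \<open>L\<close> be the set of leading monomials of the reduced Groebner basis \<open>B\<close>, and call a monomial normal
  if it has no subword in \<open>L\<close>. The proof has a linear part and a combinatorial part.

  Linear part. The non-normal monomials are exactly the leading monomials of nonzero elements of \<open>J\<close>
  (\<open>groebner_basis_normal_iff\<close>), so reduction along the well-ordering shows that the images of the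
  normal monomials of degree \<open>m\<close> form a basis of the component of degree \<open>m\<close> of the factor algebra
  (\<open>dim_factor_component\<close>). The elements of \<open>B\<close> are homogeneous, whence \<open>G(B) = G(L)\<close>
  (\<open>card_lead_reduced_groebner_basis\<close>), and \<open>L\<close> is an antichain for the subword relation.

  Combinatorial part (\<open>card_normal_eq_mseries_subst\<close>). The series \<open>H(K{x})\<close> counts the shapes of
  monomials by their number of leaves. Hence \<open>H(K{x}, G(X) - G(L))\<close> is a signed enumeration of the
  trees whose leaves are labelled either by a generator, with sign \<open>1\<close>, or by an element of \<open>L\<close>, with
  sign \<open>-1\<close> (\<open>mseries_subst_eq_sum_trees\<close>). Grafting the labels onto the leaves turns such a tree into
  a monomial, and the trees above a given monomial \<open>u\<close> have total sign \<open>1\<close> if \<open>u\<close> is normal and \<open>0\<close>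
  otherwise (\<open>sum_leaf_sign_flatten\<close>). So the enumeration counts normal monomials. This is an
  inclusion-exclusion over sets of disjoint occurrences of elements of \<open>L\<close> in \<open>u\<close>.
\<close>

section \<open>Powers of a weighted generating series\<close>

lemma finite_summands_vec: "finite {(a, b). a + b = (m :: nat ^ 'd::finite)}"
proof -
  have le: "finite {a :: nat ^ 'd. \<forall>i. a $ i \<le> m $ i}"
  proof (rule finite_subset)
    show "{a. \<forall>i. a $ i \<le> m $ i} \<subseteq> vec_lambda ` (PiE UNIV (\<lambda>i. {..m $ i}))"
    proof
      fix a :: "nat ^ 'd"
      assume "a \<in> {a. \<forall>i. a $ i \<le> m $ i}"
      then have "vec_nth a \<in> PiE UNIV (\<lambda>i. {..m $ i})" by auto
      moreover have "a = vec_lambda (vec_nth a)" by (simp add: vec_lambda_eta)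
      ultimately show "a \<in> vec_lambda ` (PiE UNIV (\<lambda>i. {..m $ i}))" by blast
    qed
    show "finite (vec_lambda ` (PiE UNIV (\<lambda>i. {..m $ i})) :: (nat ^ 'd) set)"
      by (intro finite_imageI finite_PiE) auto
  qed
  have "{(a, b). a + b = m} \<subseteq> {a. \<forall>i. a $ i \<le> m $ i} \<times> {b. \<forall>i. b $ i \<le> m $ i}"
    by auto
  then show ?thesis using le finite_subset by blast
qed

text \<open>
  Expanding the \<open>k\<close>-th power of a generating series amounts to choosing a list of \<open>k\<close> of the counted
  objects, with degrees added and weights multiplied.
\<close>

lemma mseries_power_eq_sum_lists:
  fixes d :: "'s \<Rightarrow> nat ^ 'd::finite" and \<phi> :: "'s \<Rightarrow> int"
  assumes fin: "\<And>m. finite {s \<in> S. d s = m}"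
  shows "finite {ss. set ss \<subseteq> S \<and> length ss = k \<and> sum_list (map d ss) = m} \<and>
    mseries_power (\<lambda>m. \<Sum>s | s \<in> S \<and> d s = m. \<phi> s) k m =
    (\<Sum>ss | set ss \<subseteq> S \<and> length ss = k \<and> sum_list (map d ss) = m. prod_list (map \<phi> ss))"
proof (induction k arbitrary: m)
  case 0
  have "{ss. set ss \<subseteq> S \<and> length ss = 0 \<and> sum_list (map d ss) = m} = (if m = 0 then {[]} else {})"
    by auto
  then show ?case by simp
next
  case (Suc k)
  define F where "F = (\<lambda>m. \<Sum>s | s \<in> S \<and> d s = m. \<phi> s)"
  define P where "P = (\<lambda>k m. {ss. set ss \<subseteq> S \<and> length ss = k \<and> sum_list (map d ss) = m})"
  define D where "D = {(a, b). a + b = m}"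
  define Q where "Q = (\<Union>(a, b)\<in>D. {s \<in> S. d s = a} \<times> P k b)"
  define deg2 where "deg2 = (\<lambda>(s, ss). (d s, sum_list (map d ss)))"
  have finD: "finite D" unfolding D_def by (rule finite_summands_vec)
  have finP: "finite (P k b)" for b using Suc.IH unfolding P_def by blast
  have finQ: "finite Q" unfolding Q_def using finD finP fin by auto
  have bij: "bij_betw (\<lambda>(s, ss). s # ss) Q (P (Suc k) m)"
  proof (rule bij_betwI')
    fix y assume "y \<in> P (Suc k) m"
    then obtain s ss where "y = s # ss" "s \<in> S" "ss \<in> P k (sum_list (map d ss))"
      "d s + sum_list (map d ss) = m"
      unfolding P_def by (cases y) auto
    then show "\<exists>x\<in>Q. y = (case x of (s, ss) \<Rightarrow> s # ss)"
      unfolding Q_def D_def by (intro bexI[of _ "(s, ss)"]) auto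
  qed (auto simp: Q_def D_def P_def)
  have fibre: "{x \<in> Q. deg2 x = (a, b)} = {s \<in> S. d s = a} \<times> P k b" if "(a, b) \<in> D" for a b
    using that unfolding Q_def deg2_def P_def by auto
  have "mseries_power F (Suc k) m = (\<Sum>(a, b)\<in>D. F a * mseries_power F k b)"
    by (simp add: mseries_mult_def D_def)
  also have "\<dots> = (\<Sum>(a, b)\<in>D. \<Sum>x | x \<in> Q \<and> deg2 x = (a, b). \<phi> (fst x) * prod_list (map \<phi> (snd x)))"
  proof (rule sum.cong[OF refl], clarify)
    fix a b assume ab: "(a, b) \<in> D"
    have "F a * mseries_power F k b =
        (\<Sum>s | s \<in> S \<and> d s = a. \<Sum>ss\<in>P k b. \<phi> s * prod_list (map \<phi> ss))"
      using Suc.IH[of b] unfolding F_def P_def by (simp add: sum_product)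
    also have "\<dots> = (\<Sum>x\<in>{s \<in> S. d s = a} \<times> P k b. \<phi> (fst x) * prod_list (map \<phi> (snd x)))"
      by (simp add: sum.cartesian_product split_def)
    finally show "F a * mseries_power F k b =
        (\<Sum>x | x \<in> Q \<and> deg2 x = (a, b). \<phi> (fst x) * prod_list (map \<phi> (snd x)))"
      using fibre[OF ab] by simp
  qed
  also have "\<dots> = (\<Sum>y\<in>D. \<Sum>x | x \<in> Q \<and> deg2 x = y. \<phi> (fst x) * prod_list (map \<phi> (snd x)))"
    by (simp add: split_def)
  also have "\<dots> = (\<Sum>x\<in>Q. \<phi> (fst x) * prod_list (map \<phi> (snd x)))"
    using finQ finD by (rule sum.group) (auto simp: Q_def deg2_def P_def)
  also have "\<dots> = (\<Sum>x\<in>Q. prod_list (map \<phi> (case x of (s, ss) \<Rightarrow> s # ss)))"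
    by (simp add: split_def)
  also have "\<dots> = (\<Sum>ss\<in>P (Suc k) m. prod_list (map \<phi> ss))"
    using bij by (rule sum.reindex_bij_betw)
  finally have "mseries_power F (Suc k) m = (\<Sum>ss\<in>P (Suc k) m. prod_list (map \<phi> ss))" .
  moreover have "finite (P (Suc k) m)" using bij finQ bij_betw_finite by blast
  ultimately show ?case unfolding F_def P_def by blast
qed

section \<open>Monomials as shapes with labelled leaves\<close>

lemma Var_in_omonomials_iff [simp]: "Var x \<in> omonomials \<Omega> X \<longleftrightarrow> x \<in> X"
  by (auto intro: omonomials.Var elim: omonomials.cases)

lemma Op_in_omonomials_iff [simp]:
  "Op \<nu> us \<in> omonomials \<Omega> X \<longleftrightarrow>
     2 \<le> length us \<and> \<nu> \<in> \<Omega> (length us) \<and> (\<forall>u\<in>set us. u \<in> omonomials \<Omega> X)"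
  by (auto intro: omonomials.Op elim: omonomials.cases)

primrec leaves :: "('o, 'x) omonom \<Rightarrow> 'x list" where
  "leaves (Var x) = [x]"
| "leaves (Op \<nu> us) = concat (map leaves us)"

abbreviation shape :: "('o, 'x) omonom \<Rightarrow> ('o, unit) omonom" where
  "shape \<equiv> map_omonom (\<lambda>\<nu>. \<nu>) (\<lambda>_. ())"

lemma sum_list_concat_map:
  "sum_list (map f (concat xss)) = (\<Sum>xs\<leftarrow>xss. sum_list (map f xs))"
  for f :: "'x \<Rightarrow> 'g::comm_monoid_add"
  by (induction xss) auto

lemma mdeg_eq_sum_leaves: "mdeg d t = sum_list (map d (leaves t))"
proof (induction t)
  case (Op \<nu> us)
  then show ?case
    by (auto simp: sum_list_concat_map comp_def intro!: arg_cong[where f = sum_list])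
qed simp

lemma length_leaves_shape: "length (leaves (shape t)) = length (leaves t)"
proof (induction t)
  case (Op \<nu> us)
  then show ?case
    by (auto simp: length_concat comp_def intro!: arg_cong[where f = sum_list])
qed simp

lemma mdeg_one_eq_length: "mdeg (\<lambda>_. 1 :: nat) t = length (leaves t)"
  by (simp add: mdeg_eq_sum_leaves sum_list_triv)

lemma in_omonomials_iff_shape_leaves:
  "t \<in> omonomials \<Omega> S \<longleftrightarrow> shape t \<in> omonomials \<Omega> {()} \<and> set (leaves t) \<subseteq> S"
proof (induction t)
  case (Op \<nu> us)
  then show ?case by auto
qed simp

text \<open>
  The shapes of the arguments prescribe the lengths of the pieces into which the list of leaves has to
  be cut.
\<close>

lemma shape_leaves_inject:
  "shape t = shape t' \<Longrightarrow> leaves t = leaves t' \<Longrightarrow> t = t'"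
proof (induction t arbitrary: t')
  case (Var x)
  then show ?case by (cases t') auto
next
  case (Op \<nu> us)
  from Op.prems(1) obtain us' where t': "t' = Op \<nu> us'" and sh: "map shape us = map shape us'"
    by (cases t') auto
  have len: "length us = length us'" using sh by (rule map_eq_imp_length_eq)
  have sh_nth: "shape (us ! i) = shape (us' ! i)" if "i < length us" for i
    using arg_cong[OF sh, of "\<lambda>l. l ! i"] that len by simp
  have "map leaves us = map leaves us'"
  proof (rule concat_injective)
    show "concat (map leaves us) = concat (map leaves us')" using Op.prems(2) t' by simp
    show "\<forall>(x, y)\<in>set (zip (map leaves us) (map leaves us')). length x = length y"
    proof (clarsimp simp: set_zip)
      fix i assume "i < length us"
      then show "length (leaves (us ! i)) = length (leaves (us' ! i))"
        using sh_nth length_leaves_shape by metis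
    qed
  qed (simp add: len)
  then have lv_nth: "leaves (us ! i) = leaves (us' ! i)" if "i < length us" for i
    using that len by (metis nth_map)
  have "us = us'"
    using len by (rule nth_equalityI) (use Op.IH sh_nth lv_nth in auto)
  then show ?case using t' by simp
qed

lemma exists_concat_lengths:
  "length ss = sum_list ns \<Longrightarrow> \<exists>sss. concat sss = ss \<and> map length sss = ns"
proof (induction ns arbitrary: ss)
  case (Cons n ns)
  then have "length (drop n ss) = sum_list ns" by simp
  then obtain sss where "concat sss = drop n ss" "map length sss = ns"
    using Cons.IH by blast
  then show ?case using Cons.prems by (intro exI[of _ "take n ss # sss"]) auto
qed simp

lemma exists_shape_leaves:
  "length ss = length (leaves s) \<Longrightarrow> \<exists>t. shape t = s \<and> leaves t = ss"
proof (induction s arbitrary: ss)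
  case (Var x)
  then obtain a where "ss = [a]" by (cases ss) auto
  then show ?case by (intro exI[of _ "Var a"]) auto
next
  case (Op \<nu> us)
  have "length ss = sum_list (map (\<lambda>u. length (leaves u)) us)"
    using Op.prems by (simp add: length_concat comp_def)
  from exists_concat_lengths[OF this] obtain sss
    where sss: "concat sss = ss" "map length sss = map (\<lambda>u. length (leaves u)) us" by blast
  have len: "length sss = length us" using sss(2) by (rule map_eq_imp_length_eq)
  have "\<forall>i<length us. \<exists>t. shape t = us ! i \<and> leaves t = sss ! i"
  proof (intro allI impI)
    fix i assume i: "i < length us"
    have "length (sss ! i) = length (leaves (us ! i))"
      using arg_cong[OF sss(2), of "\<lambda>l. l ! i"] i len by simp
    then show "\<exists>t. shape t = us ! i \<and> leaves t = sss ! i"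
      using Op.IH i by simp
  qed
  then obtain f where f: "\<And>i. i < length us \<Longrightarrow> shape (f i) = us ! i \<and> leaves (f i) = sss ! i"
    by metis
  have "map shape (map f [0..<length us]) = us" "map leaves (map f [0..<length us]) = sss"
    using f len by (auto intro!: nth_equalityI)
  then show ?case using sss(1) by (intro exI[of _ "Op \<nu> (map f [0..<length us])"]) simp
qed

text \<open>
  A tree with \<open>k\<close> labelled leaves is a shape with \<open>k\<close> leaves together with a list of \<open>k\<close> labels. The
  outer series counts the shapes, and the lists of labels are what the \<open>k\<close>-th power of the inner
  series enumerates. Because only finitely many labelled trees have degree \<open>m\<close>, only finitely many
  \<open>k\<close> contribute, even if the inner series has a constant term.
\<close>

lemma mseries_subst_eq_sum_trees:
  fixes d :: "'s \<Rightarrow> nat ^ 'd::finite" and \<phi> :: "'s \<Rightarrow> int"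
  assumes fin: "\<And>m. finite {s \<in> S. d s = m}"
    and fin_trees: "finite {t \<in> omonomials \<Omega> S. mdeg d t = m}"
  shows "mseries_subst (Abs_fps (\<lambda>k. int (card {s \<in> omonomials \<Omega> {()}. mdeg (\<lambda>_. 1) s = k})))
      (\<lambda>m. \<Sum>s | s \<in> S \<and> d s = m. \<phi> s) m =
    (\<Sum>t | t \<in> omonomials \<Omega> S \<and> mdeg d t = m. prod_list (map \<phi> (leaves t)))"
proof -
  define w where "w = (\<lambda>m. \<Sum>s | s \<in> S \<and> d s = m. \<phi> s)"
  define Sh where "Sh = (\<lambda>k. {s \<in> omonomials \<Omega> {()}. mdeg (\<lambda>_. 1 :: nat) s = k})"
  define P where "P = (\<lambda>k. {ss. set ss \<subseteq> S \<and> length ss = k \<and> sum_list (map d ss) = m})"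
  define T where "T = {t \<in> omonomials \<Omega> S. mdeg d t = m}"
  define \<psi> where "\<psi> = (\<lambda>t :: ('a, 's) omonom. prod_list (map \<phi> (leaves t)))"
  define nl where "nl = (\<lambda>t :: ('a, 's) omonom. length (leaves t))"
  have finT: "finite T" using fin_trees by (simp add: T_def)
  have coeff: "int (card (Sh k)) * mseries_power w k m = (\<Sum>t | t \<in> T \<and> nl t = k. \<psi> t)" for k
  proof -
    have bij: "bij_betw (\<lambda>t. (shape t, leaves t)) {t \<in> T. nl t = k} (Sh k \<times> P k)"
    proof (rule bij_betwI')
      fix t t' :: "('a, 's) omonom"
      show "(shape t, leaves t) = (shape t', leaves t') \<longleftrightarrow> t = t'"
        using shape_leaves_inject by auto
    next
      fix t assume "t \<in> {t \<in> T. nl t = k}"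
      then show "(shape t, leaves t) \<in> Sh k \<times> P k"
        using in_omonomials_iff_shape_leaves[of t \<Omega> S]
        by (auto simp: T_def nl_def Sh_def P_def mdeg_one_eq_length[simplified]
            length_leaves_shape mdeg_eq_sum_leaves[of d])
    next
      fix y assume y: "y \<in> Sh k \<times> P k"
      then have "length (snd y) = length (leaves (fst y))"
        by (auto simp: Sh_def P_def mdeg_one_eq_length[simplified])
      then obtain t where "shape t = fst y" "leaves t = snd y"
        using exists_shape_leaves by blast
      then show "\<exists>t\<in>{t \<in> T. nl t = k}. y = (shape t, leaves t)"
        using y in_omonomials_iff_shape_leaves[of t \<Omega> S]
        by (intro bexI[of _ t]) (auto simp: Sh_def P_def T_def nl_def mdeg_eq_sum_leaves[of d])
    qed
    have "(\<Sum>t | t \<in> T \<and> nl t = k. \<psi> t) =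
        (\<Sum>t | t \<in> T \<and> nl t = k. (\<lambda>(s, ss). prod_list (map \<phi> ss)) (shape t, leaves t))"
      by (simp add: \<psi>_def)
    also have "\<dots> = (\<Sum>(s, ss)\<in>Sh k \<times> P k. prod_list (map \<phi> ss))"
      using bij by (rule sum.reindex_bij_betw)
    also have "\<dots> = (\<Sum>s\<in>Sh k. \<Sum>ss\<in>P k. prod_list (map \<phi> ss))"
      by (rule sum.cartesian_product[symmetric])
    also have "\<dots> = int (card (Sh k)) * mseries_power w k m"
      using mseries_power_eq_sum_lists[OF fin, where \<phi> = \<phi> and k = k and m = m]
      by (simp add: P_def w_def)
    finally show ?thesis by simp
  qed
  have "mseries_subst (Abs_fps (\<lambda>k. int (card (Sh k)))) w m =
      (\<Sum>k | int (card (Sh k)) * mseries_power w k m \<noteq> 0. int (card (Sh k)) * mseries_power w k m)"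
    by (simp add: mseries_subst_def)
  also have "\<dots> = (\<Sum>k\<in>nl ` T. int (card (Sh k)) * mseries_power w k m)"
  proof (rule sum.mono_neutral_left)
    show "{k. int (card (Sh k)) * mseries_power w k m \<noteq> 0} \<subseteq> nl ` T"
    proof
      fix k assume "k \<in> {k. int (card (Sh k)) * mseries_power w k m \<noteq> 0}"
      then have "(\<Sum>t | t \<in> T \<and> nl t = k. \<psi> t) \<noteq> 0" unfolding coeff by simp
      then have "{t \<in> T. nl t = k} \<noteq> {}" by (metis sum.empty)
      then show "k \<in> nl ` T" by blast
    qed
  qed (use finT in auto)
  also have "\<dots> = (\<Sum>k\<in>nl ` T. \<Sum>t | t \<in> T \<and> nl t = k. \<psi> t)"
    using coeff by simp
  also have "\<dots> = (\<Sum>t\<in>T. \<psi> t)"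
    using finT by (intro sum.group) auto
  finally show ?thesis by (simp add: T_def \<psi>_def w_def Sh_def)
qed

section \<open>Counting the monomials that avoid an antichain\<close>

lemma subword_Var_iff [simp]: "subword v (Var x) \<longleftrightarrow> v = Var x"
  by (auto intro: subword.self elim: subword.cases)

lemma subword_Op_iff: "subword v (Op \<nu> us) \<longleftrightarrow> v = Op \<nu> us \<or> (\<exists>w\<in>set us. subword v w)"
  by (auto intro: subword.intros elim: subword.cases)

definition normal :: "('o, 'x) omonom set \<Rightarrow> ('o, 'x) omonom \<Rightarrow> bool" where
  "normal L u \<longleftrightarrow> (\<forall>v\<in>L. \<not> subword v u)"

lemma size_subword_le: "subword v u \<Longrightarrow> size v \<le> size u"
proof (induction rule: subword.induct)
  case (arg w us v \<nu>)
  then show ?case using member_le_sum_list[of "size w" "map size us"]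
    by (simp add: size_list_conv_sum_list)
qed simp

lemma size_arg_less: "w \<in> set us \<Longrightarrow> size w < size (Op \<nu> us)"
  using size_list_estimation'[of w us "size w" size] by fastforce

lemma sum_prod_listset:
  fixes f :: "'s \<Rightarrow> int"
  assumes "\<forall>A\<in>set As. finite A"
  shows "finite (listset As) \<and>
    (\<Sum>ts\<in>listset As. prod_list (map f ts)) = prod_list (map (sum f) As)"
  using assms
proof (induction As)
  case (Cons A As)
  have bij: "bij_betw (\<lambda>(t, ts). t # ts) (A \<times> listset As) (listset (A # As))"
    by (rule bij_betwI') (auto simp: set_Cons_def)
  have "(\<Sum>ts\<in>listset (A # As). prod_list (map f ts)) =
      (\<Sum>x\<in>A \<times> listset As. prod_list (map f (case x of (t, ts) \<Rightarrow> t # ts)))"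
    using sum.reindex_bij_betw[OF bij, of "\<lambda>ts. prod_list (map f ts)"] by simp
  also have "\<dots> = (\<Sum>t\<in>A. \<Sum>ts\<in>listset As. f t * prod_list (map f ts))"
    by (simp add: sum.cartesian_product split_def)
  also have "\<dots> = prod_list (map (sum f) (A # As))"
    using Cons by (simp flip: sum_distrib_left sum_distrib_right)
  finally show ?case
    using Cons bij bij_betw_finite by fastforce
qed simp

lemma listset_map_iff:
  "ts \<in> listset (map A us) \<longleftrightarrow> length ts = length us \<and> (\<forall>i<length us. ts ! i \<in> A (us ! i))"
proof (induction us arbitrary: ts)
  case (Cons u us)
  show ?case
  proof (cases ts)
    case (Cons t ts')
    then show ?thesis using Cons.IH
      by (auto simp: set_Cons_def All_less_Suc2)
  qed (auto simp: set_Cons_def)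
qed simp

text \<open>
  A label \<open>(v, s)\<close> carries the monomial \<open>v\<close> that is to be grafted onto the leaf, and its sign \<open>s\<close>.
  A variable that belongs to \<open>L\<close> occurs with both signs.
\<close>

primrec flatten :: "('o, ('o, 'x) omonom \<times> int) omonom \<Rightarrow> ('o, 'x) omonom" where
  "flatten (Var p) = fst p"
| "flatten (Op \<nu> ts) = Op \<nu> (map flatten ts)"

definition signed_labels :: "('o, 'x) omonom set \<Rightarrow> 'x set \<Rightarrow> (('o, 'x) omonom \<times> int) set" where
  "signed_labels L X = Var ` X \<times> {1} \<union> L \<times> {-1}"

definition leaf_sign :: "('o, ('o, 'x) omonom \<times> int) omonom \<Rightarrow> int" where
  "leaf_sign t = prod_list (map snd (leaves t))"

lemma leaf_sign_Var [simp]: "leaf_sign (Var p) = snd p"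
  by (simp add: leaf_sign_def)

lemma leaf_sign_Op [simp]: "leaf_sign (Op \<nu> ts) = prod_list (map leaf_sign ts)"
  by (induction ts) (auto simp: leaf_sign_def)

lemma mdeg_flatten: "mdeg (mdeg deg \<circ> fst) t = mdeg deg (flatten t)"
proof (induction t)
  case (Op \<nu> ts)
  then show ?case by (auto simp: comp_def intro!: arg_cong[where f = sum_list])
qed simp

lemma flatten_in_omonomials:
  assumes "L \<subseteq> omonomials \<Omega> X"
  shows "t \<in> omonomials \<Omega> (signed_labels L X) \<Longrightarrow> flatten t \<in> omonomials \<Omega> X"
proof (induction t)
  case (Var p)
  then show ?case using assms by (auto simp: signed_labels_def)
next
  case (Op \<nu> ts)
  then show ?case by auto
qed

text \<open>
  The trees that flatten to \<open>u\<close> are the ways of cutting \<open>u\<close> at disjoint occurrences of elements of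
  \<open>L\<close>, and the sign records the parity of the number of cuts. A tree above \<open>\<nu>(u\<^sub>1, \<dots>, u\<^sub>n)\<close> is
  either given by trees above the arguments, which contribute the product of the sums for the \<open>u\<^sub>i\<close>,
  or it is a single leaf, which contributes \<open>-1\<close> and exists only for a monomial in \<open>L\<close>. By the
  antichain property, the second kind occurs only if all \<open>u\<^sub>i\<close> are normal, where it cancels the
  product \<open>1\<close>.
\<close>

lemma sum_leaf_sign_flatten:
  assumes anti: "\<And>v w. v \<in> L \<Longrightarrow> w \<in> L \<Longrightarrow> subword v w \<Longrightarrow> v = w"
  shows "u \<in> omonomials \<Omega> X \<Longrightarrow>
    finite {t \<in> omonomials \<Omega> (signed_labels L X). flatten t = u} \<and>
    (\<Sum>t | t \<in> omonomials \<Omega> (signed_labels L X) \<and> flatten t = u. leaf_sign t) = of_bool (normal L u)"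
proof (induction u)
  case (Var x)
  have "{t \<in> omonomials \<Omega> (signed_labels L X). flatten t = Var x} =
      {Var (Var x, 1)} \<union> (if Var x \<in> L then {Var (Var x, -1)} else {})" (is "?A = ?B")
  proof
    show "?A \<subseteq> ?B"
    proof
      fix t assume "t \<in> ?A"
      then show "t \<in> ?B" by (cases t) (auto simp: signed_labels_def)
    qed
    show "?B \<subseteq> ?A" using Var by (auto simp: signed_labels_def split: if_splits)
  qed
  then show ?case by (auto simp: normal_def)
next
  case (Op \<nu> us)
  define A where "A = (\<lambda>u. {t \<in> omonomials \<Omega> (signed_labels L X). flatten t = u})"
  have us: "2 \<le> length us" "\<nu> \<in> \<Omega> (length us)" "\<And>u. u \<in> set us \<Longrightarrow> u \<in> omonomials \<Omega> X"
    using Op.prems by auto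
  have IH: "finite (A u)" "sum leaf_sign (A u) = of_bool (normal L u)" if "u \<in> set us" for u
    using Op.IH[OF that us(3)[OF that]] by (auto simp: A_def)
  \<comment> \<open>\<open>C\<close> collects the trees cut inside the arguments, \<open>E\<close> the tree cut at the root.\<close>
  define C where "C = listset (map A us)"
  define E where "E = (if Op \<nu> us \<in> L then {Var (Op \<nu> us, -1 :: int)} else {}
     :: ('a, ('a, 'b) omonom \<times> int) omonom set)"
  have fin: "\<forall>a\<in>set (map A us). finite a" using IH(1) by auto
  have C: "finite C" "(\<Sum>ts\<in>C. prod_list (map leaf_sign ts)) = prod_list (map (sum leaf_sign) (map A us))"
    using sum_prod_listset[OF fin, of leaf_sign] unfolding C_def by auto
  have A: "A (Op \<nu> us) = Op \<nu> ` C \<union> E"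
  proof
    show "A (Op \<nu> us) \<subseteq> Op \<nu> ` C \<union> E"
    proof
      fix t assume t: "t \<in> A (Op \<nu> us)"
      show "t \<in> Op \<nu> ` C \<union> E"
      proof (cases t)
        case (Var p)
        then show ?thesis using t by (auto simp: A_def E_def signed_labels_def)
      next
        case (Op \<mu> ts)
        then have "\<mu> = \<nu>" "map flatten ts = us" "\<forall>t\<in>set ts. t \<in> omonomials \<Omega> (signed_labels L X)"
          using t by (auto simp: A_def)
        then have "\<mu> = \<nu>" "ts \<in> C" unfolding C_def listset_map_iff by (auto simp: A_def)
        then show ?thesis using Op by auto
      qed
    qed
    show "Op \<nu> ` C \<union> E \<subseteq> A (Op \<nu> us)"
    proof
      fix t assume "t \<in> Op \<nu> ` C \<union> E"
      then consider ts where "t = Op \<nu> ts" "ts \<in> C" | "t \<in> E" by auto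
      then show "t \<in> A (Op \<nu> us)"
      proof cases
        case 1
        then have l: "length ts = length us" and n: "\<And>i. i < length us \<Longrightarrow> ts ! i \<in> A (us ! i)"
          unfolding C_def listset_map_iff by auto
        have "map flatten ts = us" using l n by (auto simp: A_def intro!: nth_equalityI)
        moreover have "\<forall>t\<in>set ts. t \<in> omonomials \<Omega> (signed_labels L X)"
          using l n by (auto simp: A_def in_set_conv_nth)
        ultimately show ?thesis using 1 us l by (auto simp: A_def)
      next
        case 2
        then show ?thesis by (auto simp: A_def E_def signed_labels_def split: if_splits)
      qed
    qed
  qed
  have finE: "finite E" by (simp add: E_def)
  have "sum leaf_sign (A (Op \<nu> us)) = sum leaf_sign (Op \<nu> ` C) + sum leaf_sign E"
    unfolding A by (rule sum.union_disjoint) (use C finE in \<open>auto simp: E_def\<close>)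
  also have "sum leaf_sign (Op \<nu> ` C) = (\<Sum>ts\<in>C. prod_list (map leaf_sign ts))"
    by (subst sum.reindex) (auto simp: inj_on_def)
  also have "\<dots> = (\<Prod>u\<leftarrow>us. of_bool (normal L u))"
    unfolding C(2) using IH(2) by (auto simp: comp_def intro!: arg_cong[where f = prod_list])
  also have "\<dots> = of_bool (\<forall>u\<in>set us. normal L u)"
    by (induction us) auto
  also have "sum leaf_sign E = - of_bool (Op \<nu> us \<in> L)"
    by (simp add: E_def)
  also have "of_bool (\<forall>u\<in>set us. normal L u) + - of_bool (Op \<nu> us \<in> L) =
      (of_bool (normal L (Op \<nu> us)) :: int)"
  proof (cases "Op \<nu> us \<in> L")
    case True
    have "normal L u" if u: "u \<in> set us" for u
      unfolding normal_def
    proof (intro ballI notI)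
      fix v assume v: "v \<in> L" "subword v u"
      then have "v = Op \<nu> us" using anti[OF v(1) True] u by (auto intro: subword.arg)
      then show False using size_subword_le[OF v(2)] size_arg_less[OF u, of \<nu>] by simp
    qed
    moreover have "\<not> normal L (Op \<nu> us)" using True by (auto simp: normal_def intro: subword.self)
    ultimately show ?thesis using True by simp
  next
    case False
    have "normal L (Op \<nu> us) \<longleftrightarrow> (\<forall>u\<in>set us. normal L u)"
      using False by (auto simp: normal_def subword_Op_iff)
    then show ?thesis using False by simp
  qed
  finally have "sum leaf_sign (A (Op \<nu> us)) = of_bool (normal L (Op \<nu> us))" .
  moreover have "finite (A (Op \<nu> us))" unfolding A using C(1) finE by auto
  ultimately show ?case by (simp add: A_def)
qed

text \<open>
  Both sides enumerate the trees of degree \<open>m\<close> with leaves labelled by \<open>signed_labels L X\<close>: the left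
  one by shape and labels, the right one by the monomial that the tree flattens to.
\<close>

lemma card_normal_eq_mseries_subst:
  fixes \<Omega> :: "nat \<Rightarrow> 'o set" and deg :: "'x \<Rightarrow> nat ^ 'd::finite"
  assumes fin: "\<And>k. finite {u \<in> omonomials \<Omega> X. mdeg deg u = k}"
    and L: "L \<subseteq> omonomials \<Omega> X"
    and anti: "\<And>v w. v \<in> L \<Longrightarrow> w \<in> L \<Longrightarrow> subword v w \<Longrightarrow> v = w"
  shows "mseries_subst (Abs_fps (\<lambda>k. int (card {s \<in> omonomials \<Omega> {()}. mdeg (\<lambda>_. 1) s = k})))
      (\<lambda>m. int (card {x \<in> X. deg x = m}) - int (card {v \<in> L. mdeg deg v = m})) m =
    int (card {u \<in> omonomials \<Omega> X. mdeg deg u = m \<and> normal L u})"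
proof -
  let ?S = "signed_labels L X"
  let ?d = "mdeg deg \<circ> fst"
  define M where "M = {u \<in> omonomials \<Omega> X. mdeg deg u = m}"
  define T where "T = {t \<in> omonomials \<Omega> ?S. mdeg ?d t = m}"
  define Fl where "Fl = (\<lambda>u. {t \<in> omonomials \<Omega> ?S. flatten t = u})"
  have finM: "finite M" unfolding M_def by (rule fin)
  have Fl: "finite (Fl u)" "sum leaf_sign (Fl u) = of_bool (normal L u)" if "u \<in> M" for u
    using sum_leaf_sign_flatten[of L u \<Omega> X] anti that by (auto simp: M_def Fl_def)
  have T_Fl: "T = (\<Union>u\<in>M. Fl u)"
    using flatten_in_omonomials[OF L] by (auto simp: T_def M_def Fl_def mdeg_flatten)
  then have finT: "finite T" using finM Fl(1) by auto
  have finV: "finite (Var ` {x \<in> X. deg x = k} :: ('o, 'x) omonom set)" for k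
    by (rule finite_subset[OF _ fin[of k]]) auto
  have finL: "finite {v \<in> L. mdeg deg v = k}" for k
    by (rule finite_subset[OF _ fin[of k]]) (use L in auto)
  have S_deg: "{s \<in> ?S. ?d s = k} = Var ` {x \<in> X. deg x = k} \<times> {1} \<union> {v \<in> L. mdeg deg v = k} \<times> {-1}"
    for k by (auto simp: signed_labels_def)
  have finS: "finite {s \<in> ?S. ?d s = k}" for k
    unfolding S_deg using finV finL by auto
  have w: "(\<Sum>s | s \<in> ?S \<and> ?d s = k. snd s) =
      int (card {x \<in> X. deg x = k}) - int (card {v \<in> L. mdeg deg v = k})" for k
  proof -
    have "(\<Sum>s | s \<in> ?S \<and> ?d s = k. snd s) =
        (\<Sum>s\<in>(Var ` {x \<in> X. deg x = k} :: ('o, 'x) omonom set) \<times> {1}. snd s) + (\<Sum>s\<in>{v \<in> L. mdeg deg v = k} \<times> {-1}. snd s)"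
      unfolding S_deg by (rule sum.union_disjoint) (use finV finL in auto)
    then show ?thesis
      by (simp add: sum.cartesian_product' card_image inj_on_def)
  qed
  have "mseries_subst (Abs_fps (\<lambda>k. int (card {s \<in> omonomials \<Omega> {()}. mdeg (\<lambda>_. 1) s = k})))
      (\<lambda>m. \<Sum>s | s \<in> ?S \<and> ?d s = m. snd s) m = (\<Sum>t\<in>T. leaf_sign t)"
    unfolding T_def leaf_sign_def by (rule mseries_subst_eq_sum_trees[OF finS finT[unfolded T_def]])
  also have "\<dots> = (\<Sum>u\<in>M. \<Sum>t | t \<in> T \<and> flatten t = u. leaf_sign t)"
    using finT finM by (rule sum.group[symmetric]) (auto simp: T_Fl Fl_def)
  also have "\<dots> = (\<Sum>u\<in>M. sum leaf_sign (Fl u))"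
    by (intro sum.cong refl) (auto simp: T_Fl Fl_def)
  also have "\<dots> = (\<Sum>u\<in>M. of_bool (normal L u))" using Fl(2) by simp
  also have "\<dots> = int (card {u \<in> M. normal L u})"
    using finM by (simp add: sum_of_bool_eq Int_def)
  finally show ?thesis unfolding w by (simp add: M_def conj_assoc)
qed

section \<open>Leading monomials\<close>

lemma lead_eqI:
  assumes "well_order_on M r" "u \<in> Poly_Mapping.keys f" "\<And>v. v \<in> Poly_Mapping.keys f \<Longrightarrow> (v, u) \<in> r"
  shows "lead r f = u"
  unfolding lead_def
proof (rule the_equality)
  show "u \<in> Poly_Mapping.keys f \<and> (\<forall>v\<in>Poly_Mapping.keys f. (v, u) \<in> r)" using assms(2,3) by simp
  fix w assume "w \<in> Poly_Mapping.keys f \<and> (\<forall>v\<in>Poly_Mapping.keys f. (v, w) \<in> r)"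
  moreover have "antisym r" using assms(1) by (simp add: order_on_defs)
  ultimately show "w = u" using assms(2,3) by (auto dest: antisymD)
qed

lemma
  assumes r: "well_order_on M r" and f: "Poly_Mapping.keys f \<subseteq> M" "f \<noteq> 0"
  shows lead_in_keys: "lead r f \<in> Poly_Mapping.keys f"
    and le_lead: "v \<in> Poly_Mapping.keys f \<Longrightarrow> (v, lead r f) \<in> r"
proof -
  have ord: "trans r" "\<And>u. u \<in> M \<Longrightarrow> (u, u) \<in> r"
      "\<And>u v. u \<in> M \<Longrightarrow> v \<in> M \<Longrightarrow> (u, v) \<in> r \<or> (v, u) \<in> r"
    using r by (auto simp: order_on_defs refl_on_def total_on_def) metis
  have "finite K \<Longrightarrow> K \<noteq> {} \<Longrightarrow> K \<subseteq> M \<Longrightarrow> \<exists>u\<in>K. \<forall>v\<in>K. (v, u) \<in> r" for K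
  proof (induction rule: finite_ne_induct)
    case (singleton x)
    then show ?case using ord(2) by auto
  next
    case (insert x F)
    then obtain u where u: "u \<in> F" "\<forall>v\<in>F. (v, u) \<in> r" by auto
    have "(x, u) \<in> r \<or> (u, x) \<in> r" using ord(3) insert.prems u(1) by auto
    then show ?case
    proof
      assume "(u, x) \<in> r"
      then have "\<forall>v\<in>insert x F. (v, x) \<in> r"
        using u(2) ord(1,2) insert.prems by (auto dest: transD)
      then show ?thesis by blast
    qed (use u in blast)
  qed
  from this[of "Poly_Mapping.keys f"] have "\<exists>u\<in>Poly_Mapping.keys f. \<forall>v\<in>Poly_Mapping.keys f. (v, u) \<in> r"
    using f by simp
  then obtain u where u: "u \<in> Poly_Mapping.keys f" "\<And>v. v \<in> Poly_Mapping.keys f \<Longrightarrow> (v, u) \<in> r"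
    by blast
  have "lead r f = u" using r u by (rule lead_eqI)
  then show "lead r f \<in> Poly_Mapping.keys f" "v \<in> Poly_Mapping.keys f \<Longrightarrow> (v, lead r f) \<in> r" using u by auto
qed

text \<open>
  Distinct choices of monomials in the factors give distinct products, and a product of nonzero
  coefficients is nonzero, so nothing cancels when the operation is expanded.
\<close>

lemma keys_omega_op: "Poly_Mapping.keys (omega_op \<nu> fs) = Op \<nu> ` listset (map Poly_Mapping.keys fs)"
proof (rule set_eqI)
  fix w
  let ?c = "\<lambda>us. \<Prod>i<length fs. Poly_Mapping.lookup (fs ! i) (us ! i)"
  have fin: "finite (listset (map Poly_Mapping.keys fs))"
    by (rule sum_prod_listset[THEN conjunct1]) auto
  have "Poly_Mapping.lookup (omega_op \<nu> fs) w = (\<Sum>us\<in>listset (map Poly_Mapping.keys fs). ?c us when Op \<nu> us = w)"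
    by (simp add: omega_op_def lookup_sum lookup_single)
  also have "\<dots> \<noteq> 0 \<longleftrightarrow> w \<in> Op \<nu> ` listset (map Poly_Mapping.keys fs)"
  proof
    assume "w \<in> Op \<nu> ` listset (map Poly_Mapping.keys fs)"
    then obtain us where us: "us \<in> listset (map Poly_Mapping.keys fs)" "w = Op \<nu> us" by blast
    have "(\<Sum>us\<in>listset (map Poly_Mapping.keys fs). ?c us when Op \<nu> us = w) = ?c us"
      using us fin by (simp add: when_def)
    moreover have "?c us \<noteq> 0"
      using us(1) unfolding listset_map_iff by (simp add: in_keys_iff)
    ultimately show "(\<Sum>us\<in>listset (map Poly_Mapping.keys fs). ?c us when Op \<nu> us = w) \<noteq> 0" by simp
  next
    assume "(\<Sum>us\<in>listset (map Poly_Mapping.keys fs). ?c us when Op \<nu> us = w) \<noteq> 0"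
    then obtain us where "us \<in> listset (map Poly_Mapping.keys fs)" "(?c us when Op \<nu> us = w) \<noteq> 0"
      by (rule sum.not_neutral_contains_not_neutral)
    then show "w \<in> Op \<nu> ` listset (map Poly_Mapping.keys fs)" by (auto simp: when_def split: if_splits)
  qed
  finally show "w \<in> Poly_Mapping.keys (omega_op \<nu> fs) \<longleftrightarrow> w \<in> Op \<nu> ` listset (map Poly_Mapping.keys fs)"
    by (simp add: in_keys_iff)
qed

lemma admissible_ordering_Op_mono:
  assumes "admissible_ordering \<Omega> X r" "Op \<nu> us \<in> omonomials \<Omega> X" "j < length us" "(u, v) \<in> r - Id"
  shows "(Op \<nu> (us[j := u]), Op \<nu> (us[j := v])) \<in> r - Id"
  using assms unfolding admissible_ordering_def by (auto simp: subset_iff)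

text \<open>
  If \<open>\<nu>(\<dots>, w, \<dots>) \<prec> w\<close>, then substituting the left-hand side for \<open>w\<close> over and over again gives an
  infinite descending chain.
\<close>

lemma arg_le_Op:
  assumes adm: "admissible_ordering \<Omega> X r" and us: "Op \<nu> us \<in> omonomials \<Omega> X" and w: "w \<in> set us"
  shows "(w, Op \<nu> us) \<in> r"
proof (rule ccontr)
  assume not_le: "(w, Op \<nu> us) \<notin> r"
  have r: "well_order_on (omonomials \<Omega> X) r" using adm by (simp add: admissible_ordering_def)
  obtain j where j: "j < length us" "us ! j = w" using w by (auto simp: in_set_conv_nth)
  define C where "C = (\<lambda>x. Op \<nu> (us[j := x]))"
  have Cw: "C w = Op \<nu> us" using j by (auto simp: C_def)
  have wX: "w \<in> omonomials \<Omega> X" using us w by auto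
  have "(w, w) \<in> r" "(C w, w) \<in> r \<or> (w, C w) \<in> r \<or> w = C w"
    using r us wX Cw by (auto simp: order_on_defs refl_on_def total_on_def)
  then have base: "(C w, w) \<in> r - Id" using not_le Cw by auto
  have "((C ^^ Suc i) w, (C ^^ i) w) \<in> r - Id" for i
  proof (induction i)
    case (Suc i)
    then show ?case using admissible_ordering_Op_mono[OF adm us j(1) Suc] by (simp add: C_def)
  qed (use base in simp)
  moreover have "wf (r - Id)" using r by (simp add: well_order_on_def)
  ultimately show False
    unfolding wf_iff_no_infinite_down_chain by (auto dest: spec[of _ "\<lambda>i. (C ^^ i) w"])
qed

lemma subword_le:
  assumes adm: "admissible_ordering \<Omega> X r"
  shows "subword v u \<Longrightarrow> u \<in> omonomials \<Omega> X \<Longrightarrow> (v, u) \<in> r"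
proof (induction rule: subword.induct)
  case (self u)
  then show ?case using adm by (auto simp: admissible_ordering_def order_on_defs refl_on_def)
next
  case (arg w us v \<nu>)
  have "(v, w) \<in> r" using arg by auto
  moreover have "(w, Op \<nu> us) \<in> r" using arg_le_Op[OF adm] arg by blast
  moreover have "trans r" using adm by (simp add: admissible_ordering_def order_on_defs)
  ultimately show ?case by (rule transD[rotated])
qed

text \<open>
  Put the element of \<open>J\<close> with leading monomial \<open>v\<close> into the context in which \<open>v\<close> occurs in \<open>u\<close>.
  Monotonicity of the ordering keeps its leading monomial in front, and over a field no coefficient
  vanishes.
\<close>

lemma lead_of_superword:
  assumes adm: "admissible_ordering \<Omega> X r" and J: "omega_ideal \<Omega> X J"
  shows "subword v u \<Longrightarrow> u \<in> omonomials \<Omega> X \<Longrightarrow> v \<in> lead r ` (J - {0}) \<Longrightarrow> u \<in> lead r ` (J - {0})"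
proof (induction rule: subword.induct)
  case (arg w us v \<nu>)
  have r: "well_order_on (omonomials \<Omega> X) r" using adm by (simp add: admissible_ordering_def)
  have us: "2 \<le> length us" "\<nu> \<in> \<Omega> (length us)" "\<And>u. u \<in> set us \<Longrightarrow> u \<in> omonomials \<Omega> X"
    using arg.prems(1) by auto
  obtain f where f: "f \<in> J" "f \<noteq> 0" "w = lead r f"
    using arg us(3) by blast
  have fX: "Poly_Mapping.keys f \<subseteq> omonomials \<Omega> X" using f(1) J by (auto simp: omega_ideal_def free_alg_def)
  obtain j where j: "j < length us" "us ! j = w"
    using arg.hyps(1) by (auto simp: in_set_conv_nth)
  define fs where "fs = (map (\<lambda>u. Poly_Mapping.single u (1::'c)) us)[j := f]"
  have len: "length fs = length us" by (simp add: fs_def)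
  have fs_nth: "fs ! i = (if i = j then f else Poly_Mapping.single (us ! i) 1)" if "i < length us" for i
    using that by (simp add: fs_def nth_list_update)
  have "set fs \<subseteq> free_alg \<Omega> X"
  proof
    fix h assume "h \<in> set fs"
    then obtain i where "i < length us" "h = fs ! i" using len by (metis in_set_conv_nth)
    then show "h \<in> free_alg \<Omega> X" using fs_nth fX us(3) by (auto simp: free_alg_def)
  qed
  moreover have "f \<in> set fs" using j(1) by (auto simp: fs_def intro: set_update_memI)
  ultimately have in_J: "omega_op \<nu> fs \<in> J"
    using J us(1,2) len f(1) unfolding omega_ideal_def by blast
  have keys: "Poly_Mapping.keys (omega_op \<nu> fs) = (\<lambda>x. Op \<nu> (us[j := x])) ` Poly_Mapping.keys f"
  proof -
    have "listset (map Poly_Mapping.keys fs) = (\<lambda>x. us[j := x]) ` Poly_Mapping.keys f"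
    proof (intro set_eqI iffI)
      fix ts assume "ts \<in> listset (map Poly_Mapping.keys fs)"
      then have l: "length ts = length us" and n: "\<And>i. i < length us \<Longrightarrow> ts ! i \<in> Poly_Mapping.keys (fs ! i)"
        using len unfolding listset_map_iff by auto
      have "ts ! i = us[j := ts ! j] ! i" if "i < length us" for i
        using n[OF that] fs_nth[OF that] that
        by (cases "i = j") (auto simp: nth_list_update)
      then have "ts = us[j := ts ! j]" using l by (intro nth_equalityI) auto
      moreover have "ts ! j \<in> Poly_Mapping.keys f" using n[OF j(1)] fs_nth[OF j(1)] by simp
      ultimately show "ts \<in> (\<lambda>x. us[j := x]) ` Poly_Mapping.keys f" by blast
    next
      fix ts assume "ts \<in> (\<lambda>x. us[j := x]) ` Poly_Mapping.keys f"
      then show "ts \<in> listset (map Poly_Mapping.keys fs)"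
        unfolding listset_map_iff using len fs_nth by (auto simp: nth_list_update)
    qed
    then show ?thesis by (simp add: keys_omega_op image_image)
  qed
  have w: "w \<in> Poly_Mapping.keys f" "\<And>x. x \<in> Poly_Mapping.keys f \<Longrightarrow> (x, w) \<in> r"
    using lead_in_keys[OF r fX f(2)] le_lead[OF r fX f(2)] f(3) by auto
  have u: "us[j := w] = us" using j by auto
  have "lead r (omega_op \<nu> fs) = Op \<nu> us"
  proof (rule lead_eqI[OF r])
    show "Op \<nu> us \<in> Poly_Mapping.keys (omega_op \<nu> fs)" unfolding keys using w(1) u by (metis imageI)
    fix y assume "y \<in> Poly_Mapping.keys (omega_op \<nu> fs)"
    then obtain x where x: "x \<in> Poly_Mapping.keys f" "y = Op \<nu> (us[j := x])" unfolding keys by blast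
    show "(y, Op \<nu> us) \<in> r"
    proof (cases "x = w")
      case True
      then show ?thesis using x u subword_le[OF adm subword.self arg.prems(1)] by simp
    next
      case False
      then show ?thesis
        using admissible_ordering_Op_mono[OF adm arg.prems(1) j(1), of x w] w(2)[OF x(1)] x(2) u
        by simp
    qed
  qed
  moreover have "omega_op \<nu> fs \<noteq> 0" using keys w(1) by auto
  ultimately show ?case using in_J by (metis DiffI imageI singletonD)
qed

lemma groebner_basis_normal_iff:
  assumes "admissible_ordering \<Omega> X r" "omega_ideal \<Omega> X J" "groebner_basis r J B" "0 \<notin> B"
    and "u \<in> omonomials \<Omega> X"
  shows "normal (lead r ` B) u \<longleftrightarrow> u \<notin> lead r ` (J - {0})"
proof
  assume n: "normal (lead r ` B) u"
  show "u \<notin> lead r ` (J - {0})"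
  proof
    assume "u \<in> lead r ` (J - {0})"
    then obtain f where "f \<in> J" "f \<noteq> 0" "u = lead r f" by auto
    then obtain g where "g \<in> B" "subword (lead r g) u"
      using assms(3) unfolding groebner_basis_def by blast
    then show False using n by (auto simp: normal_def)
  qed
next
  assume u: "u \<notin> lead r ` (J - {0})"
  show "normal (lead r ` B) u"
    unfolding normal_def
  proof (intro ballI notI)
    fix v assume v: "v \<in> lead r ` B" "subword v u"
    have "v \<in> lead r ` (J - {0})" using v(1) assms(3,4) by (auto simp: groebner_basis_def)
    then show False using lead_of_superword[OF assms(1,2) v(2) assms(5)] u by simp
  qed
qed

section \<open>Reduced Groebner bases of homogeneous ideals\<close>

lemma lookup_hom_comp:
  "Poly_Mapping.lookup (hom_comp deg k f) u = (if mdeg deg u = k then Poly_Mapping.lookup f u else 0)"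
  for f :: "('o, 'x) omonom \<Rightarrow>\<^sub>0 'k::field"
proof -
  have "Poly_Mapping.lookup (hom_comp deg k f) u =
      (\<Sum>v\<in>{v \<in> Poly_Mapping.keys f. mdeg deg v = k}. if v = u then Poly_Mapping.lookup f v else 0)"
    by (auto simp: hom_comp_def lookup_sum lookup_single when_def intro!: sum.cong)
  also have "\<dots> = (if mdeg deg u = k then Poly_Mapping.lookup f u else 0)"
    by (auto simp: in_keys_iff)
  finally show ?thesis .
qed

text \<open>
  The part of \<open>g\<close> outside the degree of its leading monomial lies in the ideal. If it were nonzero,
  its leading monomial would be a monomial of \<open>g\<close> containing some leading monomial of the basis,
  by reducedness that of \<open>g\<close> itself; but no smaller monomial has the leading monomial as a subword.
\<close>

lemma reduced_groebner_basis_homogeneous: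
  assumes adm: "admissible_ordering \<Omega> X r" and J: "omega_ideal \<Omega> X J"
    and hom: "homogeneous_subspace deg J" and B: "reduced_groebner_basis r J B" and g: "g \<in> B"
  shows "g \<in> hom_part \<Omega> X deg (mdeg deg (lead r g))"
proof -
  interpret V: vector_space pm_scale by (rule vector_space_pm_scale)
  have r: "well_order_on (omonomials \<Omega> X) r" using adm by (simp add: admissible_ordering_def)
  define k where "k = mdeg deg (lead r g)"
  define f where "f = g - hom_comp deg k g"
  have gb: "groebner_basis r J B" using B by (simp add: reduced_groebner_basis_def)
  have gJ: "g \<in> J" "g \<noteq> 0" using B g by (auto simp: reduced_groebner_basis_def groebner_basis_def)
  have JX: "Poly_Mapping.keys h \<subseteq> omonomials \<Omega> X" if "h \<in> J" for h
    using J that by (auto simp: omega_ideal_def free_alg_def)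
  have lookup_f: "Poly_Mapping.lookup f u = (if mdeg deg u = k then 0 else Poly_Mapping.lookup g u)" for u
    by (simp add: f_def lookup_minus lookup_hom_comp)
  have "f = 0"
  proof (rule ccontr)
    assume f0: "f \<noteq> 0"
    have "V.subspace J" using J by (simp add: omega_ideal_def)
    then have fJ: "f \<in> J"
      unfolding f_def using gJ(1) hom by (auto simp: homogeneous_subspace_def intro: V.subspace_diff)
    define v where "v = lead r f"
    have "v \<in> Poly_Mapping.keys f" unfolding v_def by (rule lead_in_keys[OF r JX[OF fJ] f0])
    then have v: "v \<in> Poly_Mapping.keys g" "mdeg deg v \<noteq> k"
      by (auto simp: in_keys_iff lookup_f split: if_splits)
    obtain h where h: "h \<in> B" "subword (lead r h) v"
      using gb fJ f0 unfolding groebner_basis_def v_def by blast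
    have "h = g"
      using B g h v(1) unfolding reduced_groebner_basis_def by blast
    then have "(lead r g, v) \<in> r" using subword_le[OF adm h(2)] JX[OF gJ(1)] v(1) by auto
    moreover have "(v, lead r g) \<in> r" using le_lead[OF r JX[OF gJ(1)] gJ(2) v(1)] .
    moreover have "antisym r" using r by (simp add: order_on_defs)
    ultimately have "v = lead r g" by (auto dest: antisymD)
    then show False using v(2) by (simp add: k_def)
  qed
  then have "mdeg deg u = k" if "u \<in> Poly_Mapping.keys g" for u
    using lookup_f[of u] that by (auto simp: in_keys_iff split: if_splits)
  then show ?thesis using JX[OF gJ(1)] by (auto simp: hom_part_def free_alg_def k_def)
qed

lemma card_lead_reduced_groebner_basis:
  assumes adm: "admissible_ordering \<Omega> X r" and J: "omega_ideal \<Omega> X J"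
    and hom: "homogeneous_subspace deg J" and B: "reduced_groebner_basis r J B"
  shows "card (B \<inter> hom_part \<Omega> X deg k) = card {v \<in> lead r ` B. mdeg deg v = k}"
proof -
  have r: "well_order_on (omonomials \<Omega> X) r" using adm by (simp add: admissible_ordering_def)
  have in_keys: "lead r g \<in> Poly_Mapping.keys g" if "g \<in> B" for g
  proof (rule lead_in_keys[OF r])
    show "Poly_Mapping.keys g \<subseteq> omonomials \<Omega> X" "g \<noteq> 0"
      using that B J by (auto simp: reduced_groebner_basis_def groebner_basis_def omega_ideal_def free_alg_def)
  qed
  have inj: "inj_on (lead r) B"
  proof (rule inj_onI, rule ccontr)
    fix g h assume "g \<in> B" "h \<in> B" "lead r g = lead r h" "g \<noteq> h"
    then show False
      using B in_keys[of g] unfolding reduced_groebner_basis_def by (metis subword.self)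
  qed
  have "lead r ` (B \<inter> hom_part \<Omega> X deg k) = {v \<in> lead r ` B. mdeg deg v = k}"
    using reduced_groebner_basis_homogeneous[OF adm J hom B] in_keys
    by (auto simp: hom_part_def)
  then show ?thesis using inj by (metis card_image inj_on_Int)
qed

lemma reduced_groebner_basis_lead_antichain:
  assumes adm: "admissible_ordering \<Omega> X r" and J: "omega_ideal \<Omega> X J"
    and B: "reduced_groebner_basis r J B"
    and "v \<in> lead r ` B" "w \<in> lead r ` B" "subword v w"
  shows "v = w"
proof -
  have r: "well_order_on (omonomials \<Omega> X) r" using adm by (simp add: admissible_ordering_def)
  obtain g h where gh: "g \<in> B" "v = lead r g" "h \<in> B" "w = lead r h" using assms(4,5) by blast
  have "lead r h \<in> Poly_Mapping.keys h"
  proof (rule lead_in_keys[OF r])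
    show "Poly_Mapping.keys h \<subseteq> omonomials \<Omega> X" "h \<noteq> 0"
      using gh(3) B J by (auto simp: reduced_groebner_basis_def groebner_basis_def omega_ideal_def free_alg_def)
  qed
  then have "g = h" using B gh assms(6) unfolding reduced_groebner_basis_def by metis
  then show ?thesis using gh by simp
qed

section \<open>Dimensions of homogeneous components\<close>

text \<open>
  Independence is asked of the family \<open>e\<close> rather than of its image, so that \<open>e\<close> is injective on \<open>M\<close> and
  the dimension is the number of indices.
\<close>

lemma dim_eq_card_family:
  fixes scl :: "'k::field \<Rightarrow> 'v::ab_group_add \<Rightarrow> 'v"
  assumes "vector_space scl"
    and indep: "\<And>F c. finite F \<Longrightarrow> F \<subseteq> M \<Longrightarrow> (\<Sum>u\<in>F. scl (c u) (e u)) = 0 \<Longrightarrow> \<forall>u\<in>F. c u = 0"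
    and "e ` M \<subseteq> V" and "V \<subseteq> module.span scl (e ` M)"
  shows "vector_space.dim scl V = card M"
proof -
  interpret V: vector_space scl by fact
  have inj: "inj_on e M"
  proof (rule inj_onI, rule ccontr)
    fix x y assume xy: "x \<in> M" "y \<in> M" "e x = e y" "x \<noteq> y"
    have "(\<Sum>u\<in>{x, y}. scl (if u = x then 1 else -1) (e u)) = 0"
      using xy by (simp add: V.scale_minus_left)
    from indep[OF _ _ this] have "(1 :: 'k) = 0" using xy by auto
    then show False by simp
  qed
  have "V.independent (e ` M)"
    unfolding V.independent_explicit_finite_subsets
  proof (intro allI impI)
    fix S c assume S: "S \<subseteq> e ` M" "finite S" "(\<Sum>v\<in>S. scl (c v) v) = 0"
    then obtain F where F: "F \<subseteq> M" "finite F" "S = e ` F" by (meson finite_subset_image)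
    have "(\<Sum>u\<in>F. scl (c (e u)) (e u)) = 0"
      using S(3) F inj by (simp add: sum.reindex inj_on_subset)
    then show "\<forall>v\<in>S. c v = 0" using indep[OF F(2,1), of "\<lambda>u. c (e u)"] F(3) by blast
  qed
  then have "V.dim V = card (e ` M)"
    using assms(3,4) by (metis V.dim_unique)
  then show ?thesis using inj by (simp add: card_image)
qed

lemma lookup_sum_single:
  "finite F \<Longrightarrow> Poly_Mapping.lookup (\<Sum>v\<in>F. Poly_Mapping.single v (c v)) u = (if u \<in> F then c u else 0)"
  by (simp add: lookup_sum lookup_single when_def)

lemma sum_keys_single: "(\<Sum>v\<in>Poly_Mapping.keys f. Poly_Mapping.single v (Poly_Mapping.lookup f v)) = f"
  by (rule poly_mapping_eqI) (simp add: lookup_sum_single in_keys_iff)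

lemma pm_scale_single: "pm_scale c (Poly_Mapping.single v a) = Poly_Mapping.single v (c * a)"
  by (rule poly_mapping_eqI) (simp add: lookup_single when_def)

lemma hilbert_one_gen_eq:
  fixes \<Omega> :: "nat \<Rightarrow> 'o set"
  shows "hilbert_one_gen TYPE('k::field) \<Omega> =
    Abs_fps (\<lambda>k. int (card {s \<in> omonomials \<Omega> {()}. mdeg (\<lambda>_. 1) s = k}))"
proof -
  have "vector_space.dim pm_scale (hom_part \<Omega> {()} (\<lambda>_. 1) k :: (('o, unit) omonom \<Rightarrow>\<^sub>0 'k) set) =
      card {s \<in> omonomials \<Omega> {()}. mdeg (\<lambda>_. 1) s = k}" (is "vector_space.dim _ ?V = card ?M")
    for k :: nat
  proof (rule dim_eq_card_family[OF vector_space_pm_scale])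
    interpret V: vector_space "pm_scale :: 'k \<Rightarrow> (('o, unit) omonom \<Rightarrow>\<^sub>0 'k) \<Rightarrow> _"
      by (rule vector_space_pm_scale)
    let ?e = "\<lambda>u. Poly_Mapping.single u 1 :: ('o, unit) omonom \<Rightarrow>\<^sub>0 'k"
    show "\<forall>u\<in>F. c u = 0" if "finite F" "(\<Sum>u\<in>F. pm_scale (c u) (?e u)) = 0" for F c
    proof
      fix u assume "u \<in> F"
      then have "c u = Poly_Mapping.lookup (\<Sum>u\<in>F. pm_scale (c u) (?e u)) u"
        using that(1) by (simp add: pm_scale_single lookup_sum_single)
      then show "c u = 0" using that(2) by simp
    qed
    show "?e ` ?M \<subseteq> ?V" by (auto simp: hom_part_def free_alg_def)
    show "?V \<subseteq> V.span (?e ` ?M)"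
    proof
      fix f assume f: "f \<in> ?V"
      have "(\<Sum>v\<in>Poly_Mapping.keys f. pm_scale (Poly_Mapping.lookup f v) (?e v)) \<in> V.span (?e ` ?M)"
        by (intro V.span_sum V.span_scale V.span_base)
          (use f in \<open>auto simp: hom_part_def free_alg_def\<close>)
      then show "f \<in> V.span (?e ` ?M)" by (simp add: pm_scale_single sum_keys_single)
    qed
  qed
  then show ?thesis by (simp add: hilbert_one_gen_def hilbert_series_def)
qed

lemma factor_map_sum:
  fixes c :: "('o, 'x) omonom \<Rightarrow> 'k::field"
  assumes A: "factor_algebra \<Omega> X J scaleA opA A \<pi>"
  shows "finite F \<Longrightarrow> F \<subseteq> omonomials \<Omega> X \<Longrightarrow>
    \<pi> (\<Sum>v\<in>F. Poly_Mapping.single v (c v)) = (\<Sum>v\<in>F. scaleA (c v) (\<pi> (Poly_Mapping.single v 1)))"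
proof (induction rule: finite_induct)
  case empty
  have "0 \<in> free_alg \<Omega> X" by (simp add: free_alg_def)
  then have "\<pi> (0 + 0) = \<pi> 0 + \<pi> 0"
    using A unfolding factor_algebra_def by blast
  then show ?case by simp
next
  case (insert x F)
  have add: "\<And>f g. f \<in> free_alg \<Omega> X \<Longrightarrow> g \<in> free_alg \<Omega> X \<Longrightarrow> \<pi> (f + g) = \<pi> f + \<pi> g"
    and scale: "\<And>c f. f \<in> free_alg \<Omega> X \<Longrightarrow> \<pi> (pm_scale c f) = scaleA c (\<pi> f)"
    using A unfolding factor_algebra_def by auto
  have single: "Poly_Mapping.single x a \<in> free_alg \<Omega> X" for a :: 'k
    using insert.prems by (auto simp: free_alg_def)
  have "Poly_Mapping.keys (\<Sum>v\<in>F. Poly_Mapping.single v (c v)) \<subseteq> F"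
    using insert.hyps by (auto simp: in_keys_iff lookup_sum_single split: if_splits)
  then have "(\<Sum>v\<in>F. Poly_Mapping.single v (c v)) \<in> free_alg \<Omega> X"
    using insert.prems by (auto simp: free_alg_def)
  moreover have "\<pi> (Poly_Mapping.single x (c x)) = scaleA (c x) (\<pi> (Poly_Mapping.single x 1))"
    using scale[OF single, of "c x" 1] by (simp add: pm_scale_single)
  ultimately show ?case using insert add single by simp
qed

text \<open>
  The images of the monomials of degree \<open>m\<close> that are not leading monomials of \<open>J\<close> form a basis. They
  are independent because a nonzero element of \<open>J\<close> involves its own leading monomial. They span by
  induction along the well-ordering: if \<open>u\<close> is the leading monomial of \<open>f \<in> J\<close>, the component of \<open>f\<close> of
  degree \<open>m\<close> is still in \<open>J\<close> and still contains \<open>u\<close>, and it rewrites \<open>u\<close> by smaller monomials of the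
  same degree.
\<close>

lemma dim_factor_component:
  assumes r: "well_order_on (omonomials \<Omega> X) r"
    and hom: "homogeneous_subspace deg J"
    and A: "factor_algebra \<Omega> X J scaleA opA A \<pi>"
  shows "vector_space.dim scaleA (\<pi> ` hom_part \<Omega> X deg m) =
    card {u \<in> omonomials \<Omega> X. mdeg deg u = m \<and> u \<notin> lead r ` (J - {0})}"
proof -
  interpret V: vector_space scaleA using A by (simp add: factor_algebra_def)
  define e where "e = (\<lambda>u. \<pi> (Poly_Mapping.single u 1))"
  define M where "M = {u \<in> omonomials \<Omega> X. mdeg deg u = m \<and> u \<notin> lead r ` (J - {0})}"
  have well_order: "wf (r - Id)" using r by (simp add: well_order_on_def)
  have ker: "f \<in> J \<longleftrightarrow> f \<in> free_alg \<Omega> X \<and> \<pi> f = 0" for f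
    using A unfolding factor_algebra_def by blast
  have \<pi>_sum: "\<pi> (\<Sum>v\<in>F. Poly_Mapping.single v (c v)) = (\<Sum>v\<in>F. scaleA (c v) (e v))"
    if "finite F" "F \<subseteq> omonomials \<Omega> X" for F c
    using factor_map_sum[OF A that] by (simp add: e_def)
  have \<pi>_eq: "\<pi> f = (\<Sum>v\<in>Poly_Mapping.keys f. scaleA (Poly_Mapping.lookup f v) (e v))" if "f \<in> free_alg \<Omega> X" for f
    using \<pi>_sum[of "Poly_Mapping.keys f" "Poly_Mapping.lookup f"] that by (simp add: sum_keys_single free_alg_def)
  have "V.dim (\<pi> ` hom_part \<Omega> X deg m) = card M"
  proof (rule dim_eq_card_family[where e = e])
    show "vector_space scaleA" by unfold_locales
    show "\<forall>u\<in>F. c u = 0" if F: "finite F" "F \<subseteq> M" "(\<Sum>u\<in>F. scaleA (c u) (e u)) = 0" for F c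
    proof -
      define f where "f = (\<Sum>v\<in>F. Poly_Mapping.single v (c v))"
      have lookup_f: "Poly_Mapping.lookup f u = (if u \<in> F then c u else 0)" for u
        unfolding f_def using F(1) by (rule lookup_sum_single)
      have keys_f: "Poly_Mapping.keys f \<subseteq> F" by (auto simp: in_keys_iff lookup_f split: if_splits)
      have FX: "F \<subseteq> omonomials \<Omega> X" using F(2) by (auto simp: M_def)
      have "\<pi> f = 0" using \<pi>_sum[OF F(1) FX] F(3) by (simp add: f_def)
      then have "f \<in> J" using keys_f FX by (auto simp: ker free_alg_def)
      moreover have "lead r f \<in> Poly_Mapping.keys f" if "f \<noteq> 0"
        using keys_f FX that by (intro lead_in_keys[OF r]) auto
      ultimately have "f = 0" using keys_f F(2) by (auto simp: M_def)
      then show ?thesis using lookup_f by (metis lookup_zero)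
    qed
    show "e ` M \<subseteq> \<pi> ` hom_part \<Omega> X deg m"
      by (auto simp: e_def M_def hom_part_def free_alg_def)
    have e_span: "u \<in> omonomials \<Omega> X \<Longrightarrow> mdeg deg u = m \<Longrightarrow> e u \<in> V.span (e ` M)" for u
      using well_order
    proof (induction u rule: wf_induct_rule)
      case (less u)
      show ?case
      proof (cases "u \<in> M")
        case True
        then show ?thesis by (simp add: V.span_base)
      next
        case False
        then obtain f where f: "f \<in> J" "f \<noteq> 0" "u = lead r f" using less.prems by (auto simp: M_def)
        have fX: "Poly_Mapping.keys f \<subseteq> omonomials \<Omega> X" using f(1) by (auto simp: ker free_alg_def)
        define g where "g = hom_comp deg m f"
        have gJ: "g \<in> J" using hom f(1) by (simp add: g_def homogeneous_subspace_def)
        have lookup_g: "Poly_Mapping.lookup g v = (if mdeg deg v = m then Poly_Mapping.lookup f v else 0)" for v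
          by (simp add: g_def lookup_hom_comp)
        have ug: "u \<in> Poly_Mapping.keys g"
          using lead_in_keys[OF r fX f(2)] f(3) less.prems by (simp add: in_keys_iff lookup_g)
        have smaller: "e v \<in> V.span (e ` M)" if v: "v \<in> Poly_Mapping.keys g - {u}" for v
        proof -
          have "v \<in> Poly_Mapping.keys f" "mdeg deg v = m"
            using v by (auto simp: in_keys_iff lookup_g split: if_splits)
          then show ?thesis
            using less.IH[of v] le_lead[OF r fX f(2)] f(3) fX v by auto
        qed
        have "0 = (\<Sum>v\<in>Poly_Mapping.keys g. scaleA (Poly_Mapping.lookup g v) (e v))"
          using gJ \<pi>_eq[of g] by (simp add: ker)
        also have "\<dots> = scaleA (Poly_Mapping.lookup g u) (e u) + (\<Sum>v\<in>Poly_Mapping.keys g - {u}. scaleA (Poly_Mapping.lookup g v) (e v))"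
          using ug by (simp add: sum.remove)
        finally have "scaleA (Poly_Mapping.lookup g u) (e u) = - (\<Sum>v\<in>Poly_Mapping.keys g - {u}. scaleA (Poly_Mapping.lookup g v) (e v))"
          by (simp add: eq_neg_iff_add_eq_0)
        moreover have "(\<Sum>v\<in>Poly_Mapping.keys g - {u}. scaleA (Poly_Mapping.lookup g v) (e v)) \<in> V.span (e ` M)"
          using smaller by (intro V.span_sum V.span_scale)
        ultimately have "scaleA (Poly_Mapping.lookup g u) (e u) \<in> V.span (e ` M)"
          by (simp add: V.span_neg)
        then have "scaleA (inverse (Poly_Mapping.lookup g u)) (scaleA (Poly_Mapping.lookup g u) (e u)) \<in> V.span (e ` M)"
          by (rule V.span_scale)
        then show ?thesis using ug by (simp add: in_keys_iff)
      qed
    qed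
    show "\<pi> ` hom_part \<Omega> X deg m \<subseteq> V.span (e ` M)"
    proof
      fix a assume "a \<in> \<pi> ` hom_part \<Omega> X deg m"
      then obtain f where f: "f \<in> free_alg \<Omega> X" "\<And>u. u \<in> Poly_Mapping.keys f \<Longrightarrow> mdeg deg u = m" "a = \<pi> f"
        by (auto simp: hom_part_def)
      have "(\<Sum>v\<in>Poly_Mapping.keys f. scaleA (Poly_Mapping.lookup f v) (e v)) \<in> V.span (e ` M)"
        using e_span f by (intro V.span_sum V.span_scale) (auto simp: free_alg_def)
      then show "a \<in> V.span (e ` M)" using \<pi>_eq[OF f(1)] f(3) by simp
    qed
  qed
  then show ?thesis by (simp add: M_def)
qed

section \<open>The Hilbert series of the factor algebra\<close>

theorem theorem3p9:
  fixes \<Omega> :: "nat \<Rightarrow> 'o set"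
    and X :: "'x set"
    and deg :: "'x \<Rightarrow> nat ^ 'd"
    and r :: "(('o, 'x) omonom \<times> ('o, 'x) omonom) set"
    and J B :: "(('o, 'x) omonom \<Rightarrow>\<^sub>0 'k::field) set"
    and scaleA :: "'k \<Rightarrow> 'a::ab_group_add \<Rightarrow> 'a"
    and opA :: "'o \<Rightarrow> 'a list \<Rightarrow> 'a"
    and A :: "'a set"
    and \<pi> :: "(('o, 'x) omonom \<Rightarrow>\<^sub>0 'k) \<Rightarrow> 'a"
  assumes "\<And>n. finite (\<Omega> n)"
    and "countable X"
    and "\<And>k. finite {x \<in> X. deg x = k}"
    and finite_components: "\<And>k. finite {u \<in> omonomials \<Omega> X. mdeg deg u = k}"
    and "omega_ideal \<Omega> X J"
    and "homogeneous_subspace deg J"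
    and "factor_algebra \<Omega> X J scaleA opA A \<pi>"
    and "admissible_ordering \<Omega> X r"
    and "reduced_groebner_basis r J B"
  shows "hilbert_series scaleA (\<lambda>k. \<pi> ` hom_part \<Omega> X deg k) =
    mseries_subst (hilbert_one_gen TYPE('k) \<Omega>)
      (\<lambda>m. generating_series (\<lambda>k. {x \<in> X. deg x = k}) m -
           generating_series (\<lambda>k. B \<inter> hom_part \<Omega> X deg k) m)"
proof
  fix m
  have r: "well_order_on (omonomials \<Omega> X) r"
    using assms(8) by (simp add: admissible_ordering_def)
  have B: "groebner_basis r J B" "0 \<notin> B"
    using assms(9) by (auto simp: reduced_groebner_basis_def)
  have L: "lead r ` B \<subseteq> omonomials \<Omega> X"
  proof
    fix v assume "v \<in> lead r ` B"
    then obtain g where g: "g \<in> B" "v = lead r g" by blast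
    then have "g \<noteq> 0" "Poly_Mapping.keys g \<subseteq> omonomials \<Omega> X"
      using B assms(5) by (auto simp: groebner_basis_def omega_ideal_def free_alg_def)
    then show "v \<in> omonomials \<Omega> X" using lead_in_keys[OF r] g(2) by blast
  qed
  have "hilbert_series scaleA (\<lambda>k. \<pi> ` hom_part \<Omega> X deg k) m =
      int (card {u \<in> omonomials \<Omega> X. mdeg deg u = m \<and> u \<notin> lead r ` (J - {0})})"
    by (simp add: hilbert_series_def dim_factor_component[OF r assms(6,7)])
  also have "\<dots> = int (card {u \<in> omonomials \<Omega> X. mdeg deg u = m \<and> normal (lead r ` B) u})"
    using groebner_basis_normal_iff[OF assms(8,5) B] by (metis (lifting))
  also have "\<dots> = mseries_subst (hilbert_one_gen TYPE('k) \<Omega>)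
      (\<lambda>m. int (card {x \<in> X. deg x = m}) - int (card {v \<in> lead r ` B. mdeg deg v = m})) m"
    unfolding hilbert_one_gen_eq
    by (rule card_normal_eq_mseries_subst[symmetric, OF finite_components L])
      (rule reduced_groebner_basis_lead_antichain[OF assms(8,5,9)])
  also have "\<dots> = mseries_subst (hilbert_one_gen TYPE('k) \<Omega>)
      (\<lambda>m. generating_series (\<lambda>k. {x \<in> X. deg x = k}) m -
           generating_series (\<lambda>k. B \<inter> hom_part \<Omega> X deg k) m) m"
    by (simp add: generating_series_def card_lead_reduced_groebner_basis[OF assms(8,5,6,9)])
  finally show "hilbert_series scaleA (\<lambda>k. \<pi> ` hom_part \<Omega> X deg k) m =
      mseries_subst (hilbert_one_gen TYPE('k) \<Omega>)
        (\<lambda>m. generating_series (\<lambda>k. {x \<in> X. deg x = k}) m -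
             generating_series (\<lambda>k. B \<inter> hom_part \<Omega> X deg k) m) m" .
qed

end
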